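(* Let $d\ge 1$ and let $\mathbb{T}=(T_{ij})$ be a $d\times d$ operator matrix with $T_{ij}\in\mathcal{B}_A(\mathcal{H})$ for all $i,j\in\{1,\dots,d\}$, regarded as an operator on $\mathbb{H}=\oplus_{i=1}^d\mathcal{H}$. Then $$\omega_{\mathbb{A}}(\mathbb{T})\leq \omega(S),$$ where $S=[s_{ij}]\in\mathbb{M}_d(\mathbb{C})$ is given by $$s_{ij}=\begin{cases}\omega_A(T_{ij}) & \text{if } i=j,\\[4pt] \omega_{\mathbb{B}}\left[\begin{pmatrix}0&T_{ij}\\ T_{ji}&0\end{pmatrix}\right] & \text{if } i\neq j,\end{cases}\qquad \mathbb{B}=\begin{pmatrix}A&0\\0&A\end{pmatrix}.$$
   Context: $(\mathcal{H},\langle\cdot\mid\cdot\rangle)$ is a non-trivial complex Hilbert space, $\mathcal{B}(\mathcal{H})$ is the algebra of bounded linear operators on $\mathcal{H}$, and $A\in\mathcal{B}(\mathcal{H})$ is a fixed nonzero positive (semidefinite) operator. Put $\langle x\mid y\rangle_A=\langle Ax\mid y\rangle$ and $\|x\|_A=\langle x\mid x\rangle_A^{1/2}$. An operator $T\in\mathcal{B}(\mathcal{H})$ is $A$-bounded, written $T\in\mathcal{B}_{A^{1/2}}(\mathcal{H})$, if there is $\lambda>0$ with $\|Tx\|_A\le\lambda\|x\|_A$ for all $x\in\mathcal{H}$. For such $T$ the $A$-numerical radius is $\omega_A(T)=\sup\{|\langle Tx\mid x\rangle_A| : x\in\mathcal{H},\ \|x\|_A=1\}$. $\mathcal{B}_A(\mathcal{H})$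 is the set of $T\in\mathcal{B}(\mathcal{H})$ for which the equation $AX=T^*A$ has a solution $X\in\mathcal{B}(\mathcal{H})$ (equivalently $\mathcal{R}(T^*A)\subset\mathcal{R}(A)$, where $\mathcal{R}$ denotes range); one has $\mathcal{B}_A(\mathcal{H})\subseteq\mathcal{B}_{A^{1/2}}(\mathcal{H})$. $\mathbb{H}=\oplus_{i=1}^d\mathcal{H}$ has the inner product $\langle x,y\rangle=\sum_{k=1}^d\langle x_k\mid y_k\rangle$, and $\mathbb{A}$ is the $d\times d$ diagonal operator matrix on $\mathbb{H}$ with every diagonal entry equal to $A$. $\omega_{\mathbb{A}}$ is the notion above with $(\mathbb{H},\mathbb{A})$ in place of $(\mathcal{H},A)$, and $\omega_{\mathbb{B}}$ is the notion above with $(\mathcal{H}\oplus\mathcal{H},\mathbb{B})$ in place of $(\mathcal{H},A)$. For $S\in\mathbb{M}_d(\mathbb{C})$ (complex $d\times d$ matrices acting on $\mathbb{C}^d$), $\omega(S)=\sup\{|\langle Sx\mid x\rangle| : x\in\mathbb{C}^d,\ \|x\|=1\}$ is the classical numerical radius. *)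

theory Defs
  imports "HOL-Analysis.Analysis"
begin

section \<open>Complex Hilbert spaces\<close>

text \<open>
  The inner product is linear in the first argument and conjugate-linear in the second.
  Completeness is inherited from \<^class>\<open>banach\<close>; positive definiteness of the inner
  product follows from \<open>cinner_self\<close>.
\<close>

class chilbert_space = banach +
  fixes scaleC :: "complex \<Rightarrow> 'a \<Rightarrow> 'a" (infixr "*\<^sub>C" 75)
    and cinner :: "'a \<Rightarrow> 'a \<Rightarrow> complex"
  assumes scaleC_add_right: "c *\<^sub>C (x + y) = c *\<^sub>C x + c *\<^sub>C y"
    and scaleC_add_left: "(b + c) *\<^sub>C x = b *\<^sub>C x + c *\<^sub>C x"
    and scaleC_scaleC: "b *\<^sub>C c *\<^sub>C x = (b * c) *\<^sub>C x"
    and scaleC_of_real: "complex_of_real r *\<^sub>C x = r *\<^sub>R x"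
    and cinner_commute: "cinner x y = cnj (cinner y x)"
    and cinner_add_left: "cinner (x + y) z = cinner x z + cinner y z"
    and cinner_scaleC_left: "cinner (c *\<^sub>C x) y = c * cinner x y"
    and cinner_self: "cinner x x = complex_of_real ((norm x)\<^sup>2)"

instantiation complex :: chilbert_space
begin

definition "scaleC_complex c (x::complex) = c * x"
definition "cinner_complex (x::complex) y = x * cnj y"

instance
proof
  fix x y z b c :: complex and r :: real
  show "cinner x x = complex_of_real ((norm x)\<^sup>2)"
    by (simp only: cinner_complex_def complex_norm_square)
qed (simp_all add: scaleC_complex_def cinner_complex_def distrib_left distrib_right mult.assoc
      mult.commute scaleR_conv_of_real)

end

text \<open>
  \<open>'h ^ 'd\<close> is the direct sum of \<open>CARD('d)\<close> copies of \<open>'h\<close>; its library norm is already the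
  \<open>\<ell>\<^sup>2\<close>-norm of the norms of the components.
\<close>

instantiation vec :: (chilbert_space, finite) chilbert_space
begin

definition "scaleC_vec c (x::'a^'b) = (\<chi> i. c *\<^sub>C (x $ i))"
definition "cinner_vec (x::'a^'b) y = (\<Sum>i\<in>UNIV. cinner (x $ i) (y $ i))"

instance
proof
  fix x y z :: "'a^'b" and b c :: complex and r :: real
  show "c *\<^sub>C (x + y) = c *\<^sub>C x + c *\<^sub>C y"
    by (simp add: scaleC_vec_def vec_eq_iff scaleC_add_right)
  show "(b + c) *\<^sub>C x = b *\<^sub>C x + c *\<^sub>C x"
    by (simp add: scaleC_vec_def vec_eq_iff scaleC_add_left)
  show "b *\<^sub>C c *\<^sub>C x = (b * c) *\<^sub>C x"
    by (simp add: scaleC_vec_def vec_eq_iff scaleC_scaleC)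
  show "complex_of_real r *\<^sub>C x = r *\<^sub>R x"
    by (simp add: scaleC_vec_def vec_eq_iff scaleC_of_real)
  show "cinner x y = cnj (cinner y x)"
    unfolding cinner_vec_def cnj_sum by (rule sum.cong[OF refl]) (rule cinner_commute)
  show "cinner (x + y) z = cinner x z + cinner y z"
    by (simp add: cinner_vec_def cinner_add_left sum.distrib)
  show "cinner (c *\<^sub>C x) y = c * cinner x y"
    by (simp add: cinner_vec_def scaleC_vec_def cinner_scaleC_left sum_distrib_left)
  show "cinner x x = complex_of_real ((norm x)\<^sup>2)"
    by (simp add: cinner_vec_def cinner_self norm_vec_def L2_set_def sum_nonneg)
qed

end

instantiation prod :: (chilbert_space, chilbert_space) chilbert_space
begin

definition "scaleC_prod c (x::'a \<times> 'b) = (c *\<^sub>C fst x, c *\<^sub>C snd x)"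
definition "cinner_prod (x::'a \<times> 'b) y = cinner (fst x) (fst y) + cinner (snd x) (snd y)"

instance
proof
  fix x y z :: "'a \<times> 'b" and b c :: complex and r :: real
  show "c *\<^sub>C (x + y) = c *\<^sub>C x + c *\<^sub>C y"
    by (simp add: scaleC_prod_def scaleC_add_right)
  show "(b + c) *\<^sub>C x = b *\<^sub>C x + c *\<^sub>C x"
    by (simp add: scaleC_prod_def scaleC_add_left)
  show "b *\<^sub>C c *\<^sub>C x = (b * c) *\<^sub>C x"
    by (simp add: scaleC_prod_def scaleC_scaleC)
  show "complex_of_real r *\<^sub>C x = r *\<^sub>R x"
    by (simp add: scaleC_prod_def scaleC_of_real prod_eq_iff)
  show "cinner x y = cnj (cinner y x)"
    unfolding cinner_prod_def complex_cnj_add by (simp flip: cinner_commute)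
  show "cinner (x + y) z = cinner x z + cinner y z"
    by (simp add: cinner_prod_def cinner_add_left)
  show "cinner (c *\<^sub>C x) y = c * cinner x y"
    by (simp add: cinner_prod_def scaleC_prod_def cinner_scaleC_left algebra_simps)
  show "cinner x x = complex_of_real ((norm x)\<^sup>2)"
    by (simp add: cinner_prod_def cinner_self norm_prod_def)
qed

end

section \<open>Bounded operators, adjoints and positive operators\<close>

definition bounded_clinear :: "('a::chilbert_space \<Rightarrow> 'b::chilbert_space) \<Rightarrow> bool" where
  "bounded_clinear T \<longleftrightarrow> bounded_linear T \<and> (\<forall>c x. T (c *\<^sub>C x) = c *\<^sub>C T x)"

definition cadjoint :: "('a::chilbert_space \<Rightarrow> 'b::chilbert_space) \<Rightarrow> 'b \<Rightarrow> 'a" where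
  "cadjoint T = (THE S. \<forall>x y. cinner (T x) y = cinner x (S y))"

definition positive_operator :: "('a::chilbert_space \<Rightarrow> 'a) \<Rightarrow> bool" where
  "positive_operator A \<longleftrightarrow>
     bounded_clinear A \<and> (\<forall>x. cinner (A x) x \<in> \<real> \<and> 0 \<le> Re (cinner (A x) x))"

text \<open>Every bounded operator has an adjoint, so the description in \<open>cadjoint\<close> denotes.\<close>

lemma cinner_add_right: "cinner x (y + z) = cinner x y + cinner x (z::'a::chilbert_space)"
  by (metis cinner_commute cinner_add_left complex_cnj_add)

lemma cinner_scaleC_right: "cinner x (c *\<^sub>C y) = cnj c * cinner x (y::'a::chilbert_space)"
  by (metis cinner_commute cinner_scaleC_left complex_cnj_mult)

lemma cinner_scaleR_left: "cinner (r *\<^sub>R x) y = of_real r * cinner x (y::'a::chilbert_space)"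
  by (metis cinner_scaleC_left scaleC_of_real)

lemma cinner_scaleR_right: "cinner x (r *\<^sub>R y) = of_real r * cinner x (y::'a::chilbert_space)"
  by (metis cinner_scaleC_right scaleC_of_real complex_cnj_complex_of_real)

lemma cinner_diff_right: "cinner x (y - z) = cinner x y - cinner x (z::'a::chilbert_space)"
  using cinner_add_right[of x y "- z"] cinner_scaleR_right[of x "-1" z] by simp

lemma Re_cinner_commute: "Re (cinner y x) = Re (cinner x (y::'a::chilbert_space))"
  by (subst cinner_commute) simp

lemma norm_add_square:
  "(norm (x + y))\<^sup>2 = (norm x)\<^sup>2 + 2 * Re (cinner x y) + (norm (y::'a::chilbert_space))\<^sup>2"
proof -
  have "Re (cinner (x + y) (x + y)) =
      Re (cinner x x) + 2 * Re (cinner x y) + Re (cinner y y)"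
    by (simp add: cinner_add_left cinner_add_right Re_cinner_commute[of y x])
  then show ?thesis by (simp add: cinner_self)
qed

lemma quadratic_nonneg_imp_zero:
  fixes a b :: real
  assumes "\<And>t. 0 \<le> 2 * t * a + t\<^sup>2 * b"
  shows "a = 0"
proof (rule ccontr)
  assume "a \<noteq> 0"
  define t where "t = - a / (\<bar>b\<bar> + 1)"
  have a: "a = - (t * (\<bar>b\<bar> + 1))" by (simp add: t_def)
  have *: "2 * t * a = - 2 * t\<^sup>2 * (\<bar>b\<bar> + 1)"
    by (subst a) (simp add: power2_eq_square)
  have "t \<noteq> 0" using \<open>a \<noteq> 0\<close> by (simp add: t_def)
  then have "0 < t\<^sup>2" by simp
  moreover have "t\<^sup>2 * b \<le> t\<^sup>2 * (\<bar>b\<bar> + 1)"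
    by (intro mult_left_mono) auto
  moreover have "0 < t\<^sup>2 * (\<bar>b\<bar> + 1)"
    using \<open>0 < t\<^sup>2\<close> by (intro mult_pos_pos) auto
  ultimately show False
    using assms[of t] * by (simp add: algebra_simps)
qed

lemma Re_cinner_le_norm: "Re (cinner x y) \<le> norm x * norm (y::'a::chilbert_space)"
proof -
  have "(norm (x + y))\<^sup>2 \<le> (norm x + norm y)\<^sup>2"
    by (intro power_mono norm_triangle_ineq) simp
  then show ?thesis
    by (simp add: norm_add_square power2_sum)
qed

lemma Riesz_representation_Re:
  fixes f :: "'a::chilbert_space \<Rightarrow> real"
  assumes "bounded_linear f"
  shows "\<exists>z. \<forall>x. f x = Re (cinner x z)"
proof -
  interpret bounded_linear f by fact
  obtain K where K: "\<And>x. norm (f x) \<le> norm x * K" using bounded by blast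
  define \<phi> where "\<phi> x = (norm x)\<^sup>2 - 2 * f x" for x
  have lower: "- K\<^sup>2 \<le> \<phi> x" for x
  proof -
    have "0 \<le> (norm x - K)\<^sup>2" by simp
    then show ?thesis using K[of x] by (simp add: \<phi>_def power2_diff)
  qed
  define m where "m = Inf (range \<phi>)"
  have bdd: "bdd_below (range \<phi>)" unfolding bdd_below_def using lower by blast
  have m: "m \<le> \<phi> x" for x unfolding m_def by (rule cInf_lower[OF _ bdd]) auto
  have "\<exists>x. \<phi> x < m + 1 / Suc n" for n
    using cInf_lessD[of "range \<phi>" "m + 1 / Suc n"] by (auto simp: m_def)
  then obtain u where u: "\<And>n. \<phi> (u n) < m + 1 / Suc n" by metis
  have par: "(norm (x - y))\<^sup>2 \<le> 2 * (\<phi> x - m) + 2 * (\<phi> y - m)" for x y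
  proof -
    have "(norm (x + y))\<^sup>2 + (norm (x - y))\<^sup>2 = 2 * (norm x)\<^sup>2 + 2 * (norm y)\<^sup>2"
      using norm_add_square[of x y] norm_add_square[of x "- y"] cinner_scaleR_right[of x "-1" y]
      by simp
    moreover have "\<phi> ((1/2) *\<^sub>R (x + y)) = (norm (x + y))\<^sup>2 / 4 - f x - f y"
      by (simp add: \<phi>_def scaleR add power_divide add_divide_distrib)
    ultimately show ?thesis using m[of "(1/2) *\<^sub>R (x + y)"] by (simp add: \<phi>_def)
  qed
  have "Cauchy u"
  proof (rule metric_CauchyI)
    fix e :: real assume "0 < e"
    then have "0 < e\<^sup>2 / 4" by simp
    then obtain N where N: "1 / Suc N < e\<^sup>2 / 4"
      using nat_approx_posE by blast
    have "dist (u k) (u n) < e" if "N \<le> k" "N \<le> n" for k n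
    proof -
      have "\<phi> (u j) - m < e\<^sup>2 / 4" if "N \<le> j" for j
      proof -
        have "1 / Suc j \<le> 1 / Suc N" using that by (simp add: field_simps)
        then show ?thesis using u[of j] N by linarith
      qed
      from this[OF \<open>N \<le> k\<close>] this[OF \<open>N \<le> n\<close>]
      have "2 * (\<phi> (u k) - m) + 2 * (\<phi> (u n) - m) < e\<^sup>2" by (simp add: field_simps)
      with par[of "u k" "u n"] have "(norm (u k - u n))\<^sup>2 < e\<^sup>2" by (rule le_less_trans)
      then show ?thesis using \<open>0 < e\<close> by (simp add: dist_norm power_less_imp_less_base)
    qed
    then show "\<exists>M. \<forall>k\<ge>M. \<forall>n\<ge>M. dist (u k) (u n) < e" by blast
  qed
  then obtain z where z: "u \<longlonglongrightarrow> z" using Cauchy_convergent convergent_def by blast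
  have "(\<lambda>n. \<phi> (u n)) \<longlonglongrightarrow> \<phi> z"
    unfolding \<phi>_def by (intro tendsto_intros tendsto z)
  moreover have "(\<lambda>n. m + 1 / Suc n) \<longlonglongrightarrow> m + 0"
    by (intro tendsto_intros LIMSEQ_Suc[OF lim_1_over_n])
  ultimately have "\<phi> z \<le> m"
    using LIMSEQ_le[of "\<lambda>n. \<phi> (u n)" "\<phi> z" "\<lambda>n. m + 1 / Suc n" "m + 0"] less_imp_le[OF u]
    by auto
  have "f x = Re (cinner x z)" for x
  proof -
    have "0 \<le> 2 * t * (Re (cinner x z) - f x) + t\<^sup>2 * (norm x)\<^sup>2" for t
    proof -
      have "\<phi> z \<le> \<phi> (z + t *\<^sub>R x)" using m \<open>\<phi> z \<le> m\<close> order_trans by blast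
      then show ?thesis
        by (simp add: \<phi>_def norm_add_square add scaleR cinner_scaleR_right
            Re_cinner_commute[of x z] algebra_simps)
    qed
    from quadratic_nonneg_imp_zero[OF this] show ?thesis by simp
  qed
  then show ?thesis by blast
qed

lemma cinner_eqI:
  assumes "\<And>x. cinner x y = cinner x (z::'a::chilbert_space)"
  shows "y = z"
  using cinner_self[of "y - z"] assms[of "y - z"] by (simp add: cinner_diff_right)

lemma cinner_eq_iff_Re:
  assumes "\<And>x. Re (g x) = Re (h x)" "\<And>x. g (\<i> *\<^sub>C x) = \<i> * g x" "\<And>x. h (\<i> *\<^sub>C x) = \<i> * h x"
  shows "g x = h x"
  using assms(1)[of x] assms(1)[of "\<i> *\<^sub>C x"] assms(2,3)[of x] by (simp add: complex_eq_iff)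

lemma cadjoint:
  assumes "bounded_clinear T"
  shows "cinner (T x) y = cinner x (cadjoint T y)"
proof -
  interpret bounded_linear T using assms by (simp add: bounded_clinear_def)
  have "\<exists>z. \<forall>x. cinner (T x) y = cinner x z" for y
  proof -
    obtain K where K: "\<And>x. norm (T x) \<le> norm x * K" using bounded by blast
    have "bounded_linear (\<lambda>x. Re (cinner (T x) y))"
    proof (rule bounded_linear_intro)
      fix x
      have "Re (cinner (T x) y) \<le> norm (T x) * norm y" for x by (rule Re_cinner_le_norm)
      from this[of x] this[of "- x"]
      have "\<bar>Re (cinner (T x) y)\<bar> \<le> norm (T x) * norm y"
        using cinner_scaleR_left[of "-1" "T x" y] by (simp add: neg)
      also have "\<dots> \<le> norm x * K * norm y" by (intro mult_right_mono K) simp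
      finally show "norm (Re (cinner (T x) y)) \<le> norm x * (K * norm y)" by (simp add: ac_simps)
    qed (simp_all add: add scaleR cinner_add_left cinner_scaleR_left)
    then obtain z where z: "\<And>x. Re (cinner (T x) y) = Re (cinner x z)"
      using Riesz_representation_Re by blast
    have "cinner (T x) y = cinner x z" for x
      using z assms
      by (intro cinner_eq_iff_Re[where g = "\<lambda>x. cinner (T x) y" and h = "\<lambda>x. cinner x z"])
        (simp_all add: bounded_clinear_def cinner_scaleC_left)
    then show ?thesis by blast
  qed
  then obtain S where S: "\<forall>x y. cinner (T x) y = cinner x (S y)" by metis
  have "\<forall>x y. cinner (T x) y = cinner x (cadjoint T y)"
    unfolding cadjoint_def
  proof (rule theI[where P = "\<lambda>S. \<forall>x y. cinner (T x) y = cinner x (S y)", OF S])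
    fix S' assume S': "\<forall>x y. cinner (T x) y = cinner x (S' y)"
    have "S' y = S y" for y by (rule cinner_eqI) (metis S S')
    then show "S' = S" by blast
  qed
  then show ?thesis by blast
qed

section \<open>The semi-inner product of a positive operator\<close>

definition A_inner :: "('a::chilbert_space \<Rightarrow> 'a) \<Rightarrow> 'a \<Rightarrow> 'a \<Rightarrow> complex" where
  "A_inner A x y = cinner (A x) y"

definition A_norm :: "('a::chilbert_space \<Rightarrow> 'a) \<Rightarrow> 'a \<Rightarrow> real" where
  "A_norm A x = sqrt (Re (A_inner A x x))"

definition A_adjointable :: "('a::chilbert_space \<Rightarrow> 'a) \<Rightarrow> ('a \<Rightarrow> 'a) set" where
  "A_adjointable A =
     {T. bounded_clinear T \<and> (\<exists>X. bounded_clinear X \<and> A \<circ> X = cadjoint T \<circ> A)}"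

text \<open>
  The supremum is taken in the reals, hence is meaningful only if \<open>A \<noteq> 0\<close> is positive
  (so that \<open>A_norm A x = 1\<close> for some \<open>x\<close>) and \<open>T\<close> is \<open>A\<close>-bounded, i.e.
  \<open>A_norm A (T x) \<le> l * A_norm A x\<close> for some \<open>l\<close> and all \<open>x\<close>; this includes all \<open>T \<in> A_adjointable A\<close>, and all operator
  matrices with entries in \<open>A_adjointable A\<close> relative to the diagonal operator matrix of \<open>A\<close>.
\<close>

definition A_numerical_radius :: "('a::chilbert_space \<Rightarrow> 'a) \<Rightarrow> ('a \<Rightarrow> 'a) \<Rightarrow> real" where
  "A_numerical_radius A T = Sup {cmod (A_inner A (T x) x) | x. A_norm A x = 1}"

definition numerical_radius :: "complex^'d^'d \<Rightarrow> real" where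
  "numerical_radius S = Sup {cmod (cinner (S *v x) x) | x. norm x = 1}"

section \<open>Operator matrices\<close>

definition operator_matrix ::
    "('d::finite \<Rightarrow> 'd \<Rightarrow> 'a::chilbert_space \<Rightarrow> 'a) \<Rightarrow> 'a^'d \<Rightarrow> 'a^'d" where
  "operator_matrix T x = (\<chi> i. \<Sum>j\<in>UNIV. T i j (x $ j))"

definition diagonal_operator_matrix :: "('a::chilbert_space \<Rightarrow> 'a) \<Rightarrow> 'a^'d::finite \<Rightarrow> 'a^'d" where
  "diagonal_operator_matrix A = operator_matrix (\<lambda>i j. if i = j then A else (\<lambda>_. 0))"

definition block_operator ::
    "('a::chilbert_space \<Rightarrow> 'a) \<Rightarrow> ('a \<Rightarrow> 'a) \<Rightarrow> ('a \<Rightarrow> 'a) \<Rightarrow> ('a \<Rightarrow> 'a) \<Rightarrow> 'a \<times> 'a \<Rightarrow> 'a \<times> 'a" where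
  "block_operator P Q R S = (\<lambda>(x, y). (P x + Q y, R x + S y))"

end

theory Submission
  imports Defs
begin

text \<open>
  Write \<open>a i\<close> for the \<open>A\<close>-seminorm of the component \<open>x i\<close> of a vector \<open>x\<close> of the direct sum. The
  quadratic form of the operator matrix is half of the sum over all \<open>i\<close>, \<open>j\<close> of the symmetrized
  terms \<open>\<langle>T i j (x j), x i\<rangle> + \<langle>T j i (x i), x j\<rangle>\<close>. For \<open>i \<noteq> j\<close> such a term is the quadratic form of the
  off-diagonal block operator at the pair \<open>(x i, x j)\<close>, hence its modulus is at most the numerical radius
  \<open>s\<close> times \<open>(a i)\<^sup>2 + (a j)\<^sup>2\<close>. This is not sharp enough, but the term does not change when the pair is
  replaced by \<open>(t x i, t\<^sup>-\<^sup>1 x j)\<close>, and the best \<open>t > 0\<close> improves the bound to \<open>2 s (a i) (a j)\<close>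
  (\<open>symmetrized_term_le\<close>). The diagonal terms are at most \<open>2 s (a i)\<^sup>2\<close> with \<open>s\<close> the
  numerical radius of \<open>T i i\<close>. Adding up gives \<open>\<langle>S a, a\<rangle>\<close>, and the Euclidean norm of \<open>a\<close> is the
  seminorm of \<open>x\<close> in the direct sum.

  The analytic content is that the suprema involved are finite, that is, that an operator with an
  \<open>A\<close>-adjoint is bounded for the \<open>A\<close>-seminorm (\<open>A_adjointable_imp_A_bounded\<close>). With an \<open>A\<close>-adjoint
  \<open>X\<close> of \<open>T\<close>, the operator \<open>X \<circ> T\<close> is bounded and symmetric for the semi-inner product, and
  repeated squaring bounds its quadratic form by its ordinary operator norm times the squared
  seminorm.
\<close>

section \<open>The semi-inner product of a positive operator\<close>

lemma positive_operatorD: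
  assumes "positive_operator A"
  shows "bounded_linear A" "A (c *\<^sub>C x) = c *\<^sub>C A x"
    "Im (A_inner A x x) = 0" "0 \<le> Re (A_inner A x x)"
  using assms
  by (auto simp: positive_operator_def bounded_clinear_def A_inner_def complex_is_Real_iff)

lemma A_inner_add_left:
  assumes "positive_operator A"
  shows "A_inner A (x + y) z = A_inner A x z + A_inner A y z"
  by (simp add: A_inner_def cinner_add_left linear_add[OF bounded_linear.linear]
      positive_operatorD(1)[OF assms])

lemma A_inner_add_right: "A_inner A x (y + z) = A_inner A x y + A_inner A x z"
  by (simp add: A_inner_def cinner_add_right)

lemma A_inner_scaleC_left:
  assumes "positive_operator A"
  shows "A_inner A (c *\<^sub>C x) y = c * A_inner A x y"
  by (simp add: A_inner_def cinner_scaleC_left positive_operatorD(2)[OF assms])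

lemma A_inner_scaleC_right: "A_inner A x (c *\<^sub>C y) = cnj c * A_inner A x y"
  by (simp add: A_inner_def cinner_scaleC_right)

lemma A_inner_scaleR:
  assumes "linear A"
  shows "A_inner A (r *\<^sub>R x) y = of_real r * A_inner A x y"
    "A_inner A x (r *\<^sub>R y) = of_real r * A_inner A x y"
  by (simp_all add: A_inner_def cinner_scaleR_left cinner_scaleR_right linear_scale[OF assms])

text \<open>
  Polarization: the quadratic form is real at \<open>x + y\<close> and at \<open>\<i> x + y\<close>, which yields the imaginary
  and the real part of the identity.
\<close>

lemma A_inner_commute:
  assumes "positive_operator A"
  shows "A_inner A x y = cnj (A_inner A y x)"
proof -
  have "Im (A_inner A (u + v) (u + v)) = Im (A_inner A u v) + Im (A_inner A v u)" for u v
    using positive_operatorD(3)[OF assms]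
    by (simp add: A_inner_add_left[OF assms] A_inner_add_right)
  then have *: "Im (A_inner A u v) + Im (A_inner A v u) = 0" for u v
    using positive_operatorD(3)[OF assms] by simp
  show ?thesis
    using *[of x y] *[of "\<i> *\<^sub>C x" y]
    by (simp add: A_inner_scaleC_left[OF assms] A_inner_scaleC_right complex_eq_iff)
qed

lemma positive_operator_symmetric:
  assumes "positive_operator A"
  shows "cinner (A x) y = cinner x (A y)"
  using A_inner_commute[OF assms, of x y] cinner_commute[of x "A y"] by (simp add: A_inner_def)

lemma A_norm_nonneg: "positive_operator A \<Longrightarrow> 0 \<le> A_norm A x"
  by (simp add: A_norm_def positive_operatorD)

lemma A_norm_square: "positive_operator A \<Longrightarrow> (A_norm A x)\<^sup>2 = Re (A_inner A x x)"
  by (simp add: A_norm_def positive_operatorD)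

lemma A_inner_self:
  "positive_operator A \<Longrightarrow> A_inner A x x = of_real ((A_norm A x)\<^sup>2)"
  by (simp add: A_norm_square complex_eq_iff positive_operatorD)

lemma A_norm_scaleR:
  assumes "linear A"
  shows "A_norm A (r *\<^sub>R x) = \<bar>r\<bar> * A_norm A x"
  by (simp add: A_norm_def A_inner_scaleR[OF assms] real_sqrt_mult flip: mult.assoc)

lemma Re_A_inner_le:
  assumes "positive_operator A"
  shows "Re (A_inner A x y) \<le> A_norm A x * A_norm A y"
proof -
  define r where "r = Re (A_inner A x y)"
  have lin: "linear A" using positive_operatorD(1)[OF assms] by (rule bounded_linear.linear)
  have q: "0 \<le> (A_norm A x)\<^sup>2 + 2 * t * r + t\<^sup>2 * (A_norm A y)\<^sup>2" for t
    using positive_operatorD(4)[OF assms, of "x + t *\<^sub>R y"]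
    by (simp add: A_inner_add_left[OF assms] A_inner_add_right A_inner_scaleR[OF lin] r_def
        A_norm_square[OF assms] A_inner_commute[OF assms, of y x] algebra_simps power2_eq_square[of t])
  have "r\<^sup>2 \<le> (A_norm A x * A_norm A y)\<^sup>2"
  proof (cases "A_norm A y = 0")
    case True
    have "r = 0"
    proof (rule ccontr)
      assume "r \<noteq> 0"
      then have "2 * (- ((A_norm A x)\<^sup>2 + 1) / (2 * r)) * r = - ((A_norm A x)\<^sup>2 + 1)"
        by simp
      then show False
        using q[of "- ((A_norm A x)\<^sup>2 + 1) / (2 * r)"]
        unfolding True zero_power2 mult_zero_right by linarith
    qed
    then show ?thesis by simp
  next
    case False
    then have "2 * (- r / (A_norm A y)\<^sup>2) * r + (- r / (A_norm A y)\<^sup>2)\<^sup>2 * (A_norm A y)\<^sup>2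
        = - (r\<^sup>2 / (A_norm A y)\<^sup>2)"
      by (simp add: field_simps power2_eq_square)
    then have "r\<^sup>2 / (A_norm A y)\<^sup>2 \<le> (A_norm A x)\<^sup>2"
      using q[of "- r / (A_norm A y)\<^sup>2"] by linarith
    then show ?thesis
      using False by (simp add: pos_divide_le_eq power_mult_distrib)
  qed
  then show ?thesis
    unfolding r_def by (rule power2_le_imp_le) (simp add: A_norm_nonneg[OF assms])
qed

lemma A_Cauchy_Schwarz:
  assumes "positive_operator A"
  shows "cmod (A_inner A x y) \<le> A_norm A x * A_norm A y"
proof -
  \<comment> \<open>For a nonzero inner product, \<open>c\<close> is a phase that makes it real and positive.\<close>
  define c where "c = sgn (A_inner A x y)"
  have "cnj c * A_inner A x y = A_inner A x y * cnj (A_inner A x y) / cmod (A_inner A x y)"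
    by (simp add: c_def sgn_eq)
  also have "\<dots> = cmod (A_inner A x y)"
    by (simp add: power2_eq_square flip: complex_norm_square)
  finally have "cnj c * A_inner A x y = cmod (A_inner A x y)" .
  then have "cmod (A_inner A x y) = Re (A_inner A x (c *\<^sub>C y))"
    by (simp add: A_inner_scaleC_right)
  also have "\<dots> \<le> A_norm A x * A_norm A (c *\<^sub>C y)"
    by (rule Re_A_inner_le[OF assms])
  also have "A_norm A (c *\<^sub>C y) \<le> A_norm A y"
  proof (rule power2_le_imp_le)
    have "A_inner A (c *\<^sub>C y) (c *\<^sub>C y) = of_real ((cmod c)\<^sup>2) * A_inner A y y"
      unfolding complex_norm_square
      by (simp add: A_inner_scaleC_left[OF assms] A_inner_scaleC_right ac_simps)
    then have "(A_norm A (c *\<^sub>C y))\<^sup>2 = (cmod c)\<^sup>2 * (A_norm A y)\<^sup>2"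
      by (simp add: A_norm_square[OF assms] flip: of_real_power)
    also have "\<dots> \<le> (A_norm A y)\<^sup>2"
      by (simp add: c_def norm_sgn)
    finally show "(A_norm A (c *\<^sub>C y))\<^sup>2 \<le> (A_norm A y)\<^sup>2" .
  qed (rule A_norm_nonneg[OF assms])
  finally show ?thesis by (simp add: mult_left_mono A_norm_nonneg[OF assms])
qed

lemma positive_operator_id: "positive_operator (\<lambda>x. x)"
  by (simp add: positive_operator_def bounded_clinear_def bounded_linear_ident cinner_self)

lemma norm_cinner_le: "cmod (cinner x y) \<le> norm x * norm (y::'a::chilbert_space)"
  using A_Cauchy_Schwarz[OF positive_operator_id, of x y]
  by (simp add: A_inner_def A_norm_def cinner_self)

text \<open>
  If the seminorm vanished, then by Cauchy--Schwarz so would \<open>\<langle>A x, A x\<rangle>\<close>, which is the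
  semi-inner product of \<open>x\<close> with \<open>A x\<close>.
\<close>

lemma ex_A_norm_eq_1:
  assumes "positive_operator A" "A \<noteq> (\<lambda>_. 0)"
  shows "\<exists>x. A_norm A x = 1"
proof -
  obtain x where "A x \<noteq> 0" using assms(2) by auto
  then have "A_inner A x (A x) \<noteq> 0" by (simp add: A_inner_def cinner_self)
  then have "A_norm A x \<noteq> 0" using A_Cauchy_Schwarz[OF assms(1), of x "A x"] by auto
  then have "A_norm A ((1 / A_norm A x) *\<^sub>R x) = 1"
    using A_norm_nonneg[OF assms(1), of x]
    by (simp add: A_norm_scaleR bounded_linear.linear positive_operatorD(1)[OF assms(1)])
  then show ?thesis ..
qed

section \<open>Boundedness for the seminorm\<close>

text \<open>
  With \<open>q\<close> the modulus of \<open>\<langle>Q x, x\<rangle>\<^sub>A\<close> and \<open>n\<close> the squared seminorm of \<open>x\<close>, Cauchy--Schwarz gives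
  \<open>q\<^sup>2 \<le> \<langle>Q (Q x), x\<rangle>\<^sub>A n\<close>. Iterating doubles the exponent, while the constant \<open>\<parallel>A x\<parallel> \<parallel>x\<parallel>\<close>
  stays the same.
\<close>

lemma A_symmetric_power_bound:
  assumes "positive_operator A"
    and "\<And>y z. A_inner A (Q y) z = A_inner A y (Q z)"
    and "\<And>y. norm (Q y) \<le> K * norm y" "0 \<le> K"
  shows "cmod (A_inner A (Q x) x) ^ 2 ^ k * (A_norm A x)\<^sup>2
           \<le> (norm (A x) * norm x) * (K * (A_norm A x)\<^sup>2) ^ 2 ^ k"
  using assms(2-)
proof (induction k arbitrary: Q K)
  case 0
  have "cmod (A_inner A (Q x) x) = cmod (cinner (A x) (Q x))"
    using 0(1)[of x x] by (simp add: A_inner_def)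
  also have "\<dots> \<le> norm (A x) * (K * norm x)"
    by (rule order_trans[OF norm_cinner_le]) (simp add: 0 mult_left_mono)
  finally show ?case
    using mult_right_mono[of _ _ "(A_norm A x)\<^sup>2"] by (fastforce simp: ac_simps)
next
  case (Suc k)
  let ?n = "(A_norm A x)\<^sup>2"
  have "norm (Q (Q y)) \<le> K\<^sup>2 * norm y" for y
    using order_trans[OF Suc.prems(2)[of "Q y"] mult_left_mono[OF Suc.prems(2)[of y] Suc.prems(3)]]
    by (simp add: power2_eq_square mult.assoc)
  then have IH: "cmod (A_inner A (Q (Q x)) x) ^ 2 ^ k * ?n
      \<le> (norm (A x) * norm x) * (K\<^sup>2 * ?n) ^ 2 ^ k"
    using Suc.IH[of "\<lambda>y. Q (Q y)" "K\<^sup>2"] Suc.prems by simp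
  have "(cmod (A_inner A (Q x) x))\<^sup>2 \<le> (A_norm A (Q x) * A_norm A x)\<^sup>2"
    by (intro power_mono A_Cauchy_Schwarz[OF assms(1)]) simp
  also have "\<dots> = Re (A_inner A (Q (Q x)) x) * ?n"
    by (simp add: power_mult_distrib A_norm_square[OF assms(1)] Suc.prems(1))
  also have "\<dots> \<le> cmod (A_inner A (Q (Q x)) x) * ?n"
    by (intro mult_right_mono complex_Re_le_cmod) simp
  finally have "((cmod (A_inner A (Q x) x))\<^sup>2) ^ 2 ^ k
      \<le> (cmod (A_inner A (Q (Q x)) x) * ?n) ^ 2 ^ k"
    by (intro power_mono) auto
  then have "((cmod (A_inner A (Q x) x))\<^sup>2) ^ 2 ^ k * ?n
      \<le> (cmod (A_inner A (Q (Q x)) x) * ?n) ^ 2 ^ k * ?n"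
    by (rule mult_right_mono) simp
  also have "\<dots> = (cmod (A_inner A (Q (Q x)) x) ^ 2 ^ k * ?n) * ?n ^ 2 ^ k"
    by (simp add: power_mult_distrib)
  also have "\<dots> \<le> ((norm (A x) * norm x) * (K\<^sup>2 * ?n) ^ 2 ^ k) * ?n ^ 2 ^ k"
    by (intro mult_right_mono IH) simp
  also have "\<dots> = (norm (A x) * norm x) * ((K * ?n)\<^sup>2) ^ 2 ^ k"
    by (simp add: power_mult_distrib power2_eq_square)
  finally show ?case by (simp add: power_mult)
qed

text \<open>
  Unless the seminorm of \<open>x\<close> vanishes, dividing the previous estimate by the powers on its right-hand
  side leaves powers of a fixed ratio, bounded independently of the exponent; so the ratio is at
  most one.
\<close>

lemma A_symmetric_form_bound:
  assumes pos: "positive_operator A"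
    and sym: "\<And>y z. A_inner A (Q y) z = A_inner A y (Q z)"
    and Q: "\<And>y. norm (Q y) \<le> K * norm y" and "0 < K"
  shows "cmod (A_inner A (Q x) x) \<le> K * (A_norm A x)\<^sup>2"
proof (rule ccontr)
  define q where "q = cmod (A_inner A (Q x) x)"
  define n where "n = (A_norm A x)\<^sup>2"
  define C where "C = norm (A x) * norm x"
  assume "\<not> ?thesis"
  then have less: "K * n < q" by (simp add: q_def n_def)
  have "n \<noteq> 0"
    using A_Cauchy_Schwarz[OF pos, of "Q x" x] less by (auto simp: q_def n_def)
  then have "0 < n" by (simp add: n_def)
  then have Kn: "0 < K * n" using \<open>0 < K\<close> by simp
  have *: "(q / (K * n)) ^ 2 ^ k \<le> C / n" for k
    using A_symmetric_power_bound[OF pos sym Q, of x k] \<open>0 < K\<close> \<open>0 < n\<close> Kn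
    unfolding q_def[symmetric] n_def[symmetric] C_def[symmetric]
    by (simp add: field_simps power_divide)
  have "1 < q / (K * n)" using less Kn by simp
  then obtain k where "C / n < (q / (K * n)) ^ k"
    using real_arch_pow by blast
  also have "\<dots> \<le> (q / (K * n)) ^ 2 ^ k"
    using \<open>1 < q / (K * n)\<close> by (intro power_increasing) (auto intro: less_imp_le less_exp)
  finally show False using *[of k] by simp
qed

lemma A_adjointable_imp_A_bounded:
  assumes pos: "positive_operator A" and T: "T \<in> A_adjointable A"
  shows "\<exists>l\<ge>0. \<forall>x. A_norm A (T x) \<le> l * A_norm A x"
proof -
  obtain X where X: "bounded_clinear X" and AX: "A \<circ> X = cadjoint T \<circ> A"
    and bT: "bounded_clinear T"
    using T by (auto simp: A_adjointable_def)
  have adj: "A_inner A (T x) y = A_inner A x (X y)" for x y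
  proof -
    have "A_inner A (T x) y = cinner (T x) (A y)"
      by (simp add: A_inner_def positive_operator_symmetric[OF pos])
    also have "\<dots> = cinner x (A (X y))"
      using cadjoint[OF bT] fun_cong[OF AX, of y] by simp
    finally show ?thesis by (simp add: A_inner_def positive_operator_symmetric[OF pos])
  qed
  have adj': "A_inner A (X x) y = A_inner A x (T y)" for x y
    using adj[of y x] A_inner_commute[OF pos] by metis
  have "bounded_linear (\<lambda>x. X (T x))"
    using X bT by (auto simp: bounded_clinear_def intro: bounded_linear_compose)
  then obtain K where "0 < K" and K: "\<And>x. norm (X (T x)) \<le> norm x * K"
    using bounded_linear.pos_bounded by blast
  have "A_norm A (T x) \<le> sqrt K * A_norm A x" for x
  proof (rule power2_le_imp_le)
    have "(A_norm A (T x))\<^sup>2 = Re (A_inner A (X (T x)) x)"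
      by (simp add: A_norm_square[OF pos] adj')
    also have "\<dots> \<le> cmod (A_inner A (X (T x)) x)"
      by (rule complex_Re_le_cmod)
    also have "\<dots> \<le> K * (A_norm A x)\<^sup>2"
      using K \<open>0 < K\<close> by (intro A_symmetric_form_bound[OF pos]) (simp_all add: adj adj' mult.commute)
    finally show "(A_norm A (T x))\<^sup>2 \<le> (sqrt K * A_norm A x)\<^sup>2"
      using \<open>0 < K\<close> by (simp add: power_mult_distrib)
  qed (use \<open>0 < K\<close> in \<open>simp add: A_norm_nonneg[OF pos]\<close>)
  then show ?thesis using \<open>0 < K\<close> by (intro exI[of _ "sqrt K"]) auto
qed

lemma A_adjointable_sesquilinear_bound:
  assumes pos: "positive_operator A" and T: "T \<in> A_adjointable A"
  shows "\<exists>l\<ge>0. \<forall>x y. cmod (A_inner A (T x) y) \<le> l * (A_norm A x * A_norm A y)"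
proof -
  obtain l where l: "0 \<le> l" "\<And>x. A_norm A (T x) \<le> l * A_norm A x"
    using A_adjointable_imp_A_bounded[OF assms] by blast
  have "cmod (A_inner A (T x) y) \<le> l * (A_norm A x * A_norm A y)" for x y
    using order_trans[OF A_Cauchy_Schwarz[OF pos] mult_right_mono[OF l(2) A_norm_nonneg[OF pos]]]
    by (simp add: mult.assoc)
  with l(1) show ?thesis by blast
qed

lemma A_form_le_numerical_radius:
  assumes "linear A" "linear T" and "0 < A_norm A x"
    and bound: "\<And>y. A_norm A y = 1 \<Longrightarrow> cmod (A_inner A (T y) y) \<le> M"
  shows "cmod (A_inner A (T x) x) \<le> A_numerical_radius A T * (A_norm A x)\<^sup>2"
proof -
  define y where "y = (1 / A_norm A x) *\<^sub>R x"
  have "A_norm A y = 1" using assms(3) by (simp add: y_def A_norm_scaleR[OF assms(1)])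
  then have "cmod (A_inner A (T y) y) \<le> A_numerical_radius A T"
    unfolding A_numerical_radius_def
    by (intro cSup_upper bdd_aboveI[of _ M]) (use bound in auto)
  moreover have "cmod (A_inner A (T y) y) = cmod (A_inner A (T x) x) / (A_norm A x)\<^sup>2"
    using assms(3)
    by (simp add: y_def linear_scale[OF assms(2)] A_inner_scaleR[OF assms(1)] norm_mult
        norm_divide power2_eq_square)
  ultimately show ?thesis using assms(3) by (simp add: field_simps)
qed

section \<open>Operator matrices\<close>

lemma A_adjointable_linear: "T \<in> A_adjointable A \<Longrightarrow> linear T"
  by (simp add: A_adjointable_def bounded_clinear_def bounded_linear.linear)

lemma diagonal_entry_le:
  assumes pos: "positive_operator A" and T: "T \<in> A_adjointable A"
  shows "cmod (A_inner A (T x) x) \<le> A_numerical_radius A T * (A_norm A x)\<^sup>2"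
proof -
  obtain l where l: "0 \<le> l" "\<And>x y. cmod (A_inner A (T x) y) \<le> l * (A_norm A x * A_norm A y)"
    using A_adjointable_sesquilinear_bound[OF assms] by blast
  show ?thesis
  proof (cases "A_norm A x = 0")
    case True
    then show ?thesis using l(2)[of x x] by simp
  next
    case False
    then have "0 < A_norm A x" using A_norm_nonneg[OF pos, of x] by simp
    then show ?thesis
      using l(2)[of y y for y] bounded_linear.linear[OF positive_operatorD(1)[OF pos]]
        A_adjointable_linear[OF T]
      by (intro A_form_le_numerical_radius[where M = l]) (metis mult.right_neutral)+
  qed
qed

lemma A_inner_block_diagonal:
  "A_inner (block_operator A (\<lambda>_. 0) (\<lambda>_. 0) A) u v =
     A_inner A (fst u) (fst v) + A_inner A (snd u) (snd v)"
  by (simp add: A_inner_def block_operator_def cinner_prod_def split_beta)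

lemma linear_block_operator:
  assumes "linear P" "linear Q" "linear R" "linear S"
  shows "linear (block_operator P Q R S)"
  unfolding block_operator_def
  by (rule linearI) (simp_all add: assms linear_add linear_scale split_beta algebra_simps)

text \<open>
  For positive seminorms \<open>a\<close>, \<open>b\<close> of \<open>x\<close>, \<open>y\<close>, the rescaling \<open>(t x, t\<^sup>-\<^sup>1 y)\<close> with \<open>t\<^sup>2 = b / a\<close>
  balances the two squared seminorms, both being \<open>a b\<close>. If \<open>a\<close> or \<open>b\<close> is zero, both terms
  vanish because \<open>P\<close> and \<open>Q\<close> are bounded for the seminorm.
\<close>

lemma symmetrized_term_le:
  fixes A P Q :: "'h::chilbert_space \<Rightarrow> 'h"
  defines "B \<equiv> block_operator A (\<lambda>_. 0) (\<lambda>_. 0) A"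
    and "W \<equiv> block_operator (\<lambda>_. 0) P Q (\<lambda>_. 0)"
  assumes pos: "positive_operator A" and P: "P \<in> A_adjointable A" and Q: "Q \<in> A_adjointable A"
  shows "cmod (A_inner A (P y) x + A_inner A (Q x) y)
           \<le> 2 * (A_numerical_radius B W * (A_norm A x * A_norm A y))"
proof -
  define a b where "a = A_norm A x" and "b = A_norm A y"
  have ab: "0 \<le> a" "0 \<le> b" by (simp_all add: a_def b_def A_norm_nonneg[OF pos])
  have linA: "linear A" using positive_operatorD(1)[OF pos] by (rule bounded_linear.linear)
  note linP = A_adjointable_linear[OF P] and linQ = A_adjointable_linear[OF Q]
  obtain l where l: "0 \<le> l" "\<And>x y. cmod (A_inner A (P x) y) \<le> l * (A_norm A x * A_norm A y)"
    using A_adjointable_sesquilinear_bound[OF pos P] by blast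
  obtain m where m: "0 \<le> m" "\<And>x y. cmod (A_inner A (Q x) y) \<le> m * (A_norm A x * A_norm A y)"
    using A_adjointable_sesquilinear_bound[OF pos Q] by blast
  have form: "A_inner B (W u) u = A_inner A (P (snd u)) (fst u) + A_inner A (Q (fst u)) (snd u)"
    for u
  proof -
    have "W u = (P (snd u), Q (fst u))" by (simp add: W_def block_operator_def split_beta)
    then show ?thesis by (simp add: B_def A_inner_block_diagonal)
  qed
  have norm_B: "A_norm B u = sqrt ((A_norm A (fst u))\<^sup>2 + (A_norm A (snd u))\<^sup>2)" for u
    unfolding A_norm_def[of B] by (simp add: B_def A_inner_block_diagonal A_norm_square[OF pos])
  show ?thesis
  proof (cases "a = 0 \<or> b = 0")
    case True
    then have "A_inner A (P y) x = 0" "A_inner A (Q x) y = 0"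
      using l(2)[of y x] m(2)[of x y] by (auto simp: a_def b_def)
    then show ?thesis using True by (auto simp: a_def b_def)
  next
    case False
    then have "0 < a" "0 < b" using ab by auto
    define t where "t = sqrt (b / a)"
    have t: "0 < t" "t\<^sup>2 = b / a" using \<open>0 < a\<close> \<open>0 < b\<close> by (simp_all add: t_def)
    define u where "u = (t *\<^sub>R x, (1 / t) *\<^sub>R y)"
    have nu: "(A_norm B u)\<^sup>2 = 2 * (a * b)"
      using t \<open>0 < a\<close> \<open>0 < b\<close>
      by (simp add: norm_B u_def A_norm_scaleR[OF linA] power_mult_distrib power_divide
          flip: a_def b_def) (simp add: power2_eq_square)
    have "A_norm B u \<noteq> 0" using nu \<open>0 < a\<close> \<open>0 < b\<close> by auto
    then have "0 < A_norm B u" by (simp add: norm_B order_less_le)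
    have bound: "cmod (A_inner B (W v) v) \<le> l + m" if "A_norm B v = 1" for v
    proof -
      have *: "(A_norm A (fst v))\<^sup>2 + (A_norm A (snd v))\<^sup>2 = 1" using that by (simp add: norm_B)
      then have "(A_norm A (fst v))\<^sup>2 \<le> 1\<^sup>2" "(A_norm A (snd v))\<^sup>2 \<le> 1\<^sup>2"
        using zero_le_power2[of "A_norm A (fst v)"] zero_le_power2[of "A_norm A (snd v)"]
        unfolding one_power2 by linarith+
      then have le1: "A_norm A (fst v) \<le> 1" "A_norm A (snd v) \<le> 1"
        by (blast intro: power2_le_imp_le zero_le_one)+
      have p: "A_norm A (fst v) * A_norm A (snd v) \<le> 1"
        using mult_mono[OF le1] by (simp add: A_norm_nonneg[OF pos])
      have "cmod (A_inner A (P (snd v)) (fst v)) \<le> l"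
        using l(2)[of "snd v" "fst v"] mult_left_mono[OF p l(1)] by (simp add: mult.commute)
      moreover have "cmod (A_inner A (Q (fst v)) (snd v)) \<le> m"
        using m(2)[of "fst v" "snd v"] mult_left_mono[OF p m(1)] by simp
      ultimately show ?thesis unfolding form by (rule norm_triangle_mono)
    qed
    have "cmod (A_inner B (W u) u) \<le> A_numerical_radius B W * (A_norm B u)\<^sup>2"
      using \<open>0 < A_norm B u\<close> bound unfolding B_def W_def
      by (intro A_form_le_numerical_radius[where M = "l + m"] linear_block_operator
          linA linP linQ linear_zero)
    moreover have "A_inner B (W u) u = A_inner A (P y) x + A_inner A (Q x) y"
      using t(1)
      by (simp add: form u_def linear_scale[OF linP] linear_scale[OF linQ] A_inner_scaleR[OF linA])
    ultimately show ?thesis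
      by (simp add: nu mult.left_commute flip: a_def b_def)
  qed
qed

lemma A_inner_diagonal_operator_matrix:
  "A_inner (diagonal_operator_matrix A) x y = (\<Sum>i\<in>UNIV. A_inner A (x $ i) (y $ i))"
proof -
  have "(if i = j then A else (\<lambda>_. 0)) v = (if j = i then A v else 0)" for i j :: 'b and v
    by simp
  then show ?thesis
    by (simp add: A_inner_def cinner_vec_def diagonal_operator_matrix_def operator_matrix_def)
qed

lemma A_norm_diagonal_operator_matrix:
  assumes "positive_operator A"
  shows "A_norm (diagonal_operator_matrix A) x = norm (\<chi> i. A_norm A (x $ i))"
  by (simp add: A_norm_def[of "diagonal_operator_matrix A"] A_inner_diagonal_operator_matrix
      norm_vec_def L2_set_def A_norm_square[OF assms])

lemma A_inner_sum_left:
  assumes "positive_operator A"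
  shows "A_inner A (\<Sum>i\<in>I. f i) y = (\<Sum>i\<in>I. A_inner A (f i) y)"
proof (induction I rule: infinite_finite_induct)
  case (insert i I)
  then show ?case by (simp add: A_inner_add_left[OF assms])
qed (use A_inner_scaleC_left[OF assms, of 0 0 y] scaleC_of_real[of 0 "0::'a"] in simp_all)

lemma cinner_le_numerical_radius:
  fixes S :: "complex^'d^'d"
  assumes "norm x = 1"
  shows "cmod (cinner (S *v x) x) \<le> numerical_radius S"
proof -
  obtain K where K: "\<And>y. norm (S *v y) \<le> norm y * K"
    using bounded_linear.bounded[OF matrix_vector_mul_bounded_linear[of S]] by blast
  have "cmod (cinner (S *v y) y) \<le> K" if "norm y = 1" for y
    using norm_cinner_le[of "S *v y" y] K[of y] that by simp
  then show ?thesis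
    unfolding numerical_radius_def using assms
    by (intro cSup_upper bdd_aboveI[of _ K]) auto
qed

theorem theorem2p3:
  fixes A :: "'h::chilbert_space \<Rightarrow> 'h"
    and T :: "'d::finite \<Rightarrow> 'd \<Rightarrow> 'h \<Rightarrow> 'h"
    and B :: "'h \<times> 'h \<Rightarrow> 'h \<times> 'h"
    and S :: "complex^'d^'d"
  assumes "positive_operator A"
    and "A \<noteq> (\<lambda>_. 0)"
    and "\<And>i j. T i j \<in> A_adjointable A"
  defines "B \<equiv> block_operator A (\<lambda>_. 0) (\<lambda>_. 0) A"
    and "S \<equiv> (\<chi> i j. complex_of_real
                (if i = j then A_numerical_radius A (T i i)
                 else A_numerical_radius B (block_operator (\<lambda>_. 0) (T i j) (T j i) (\<lambda>_. 0))))"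
  shows "A_numerical_radius (diagonal_operator_matrix A) (operator_matrix T)
           \<le> numerical_radius S"
proof -
  note pos = assms(1) and T = assms(3)
  define s where "s i j = (if i = j then A_numerical_radius A (T i i)
      else A_numerical_radius B (block_operator (\<lambda>_. 0) (T i j) (T j i) (\<lambda>_. 0)))" for i j
  let ?D = "diagonal_operator_matrix A :: 'h^'d \<Rightarrow> 'h^'d"
  have "cmod (A_inner ?D (operator_matrix T x) x) \<le> numerical_radius S" if x: "A_norm ?D x = 1" for x
  proof -
    define a where "a i = A_norm A (x $ i)" for i
    define v :: "complex^'d" where "v = (\<chi> i. complex_of_real (a i))"
    define f where "f i j = A_inner A (T i j (x $ j)) (x $ i)" for i j
    have "norm v = 1"
      using x
      by (simp add: A_norm_diagonal_operator_matrix[OF pos] v_def norm_vec_def a_def)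
    have term_le: "cmod (f i j + f j i) \<le> 2 * (s i j * (a i * a j))" for i j
    proof (cases "i = j")
      case True
      then show ?thesis
        using diagonal_entry_le[OF pos T, of i i "x $ i"]
        by (simp add: f_def s_def a_def power2_eq_square norm_mult flip: mult_2)
    next
      case False
      then show ?thesis
        using symmetrized_term_le[OF pos T[of i j] T[of j i], where x = "x $ i" and y = "x $ j"]
        by (simp add: f_def s_def a_def B_def)
    qed
    have "A_inner ?D (operator_matrix T x) x = (\<Sum>i\<in>UNIV. \<Sum>j\<in>UNIV. f i j)"
      by (simp add: A_inner_diagonal_operator_matrix operator_matrix_def A_inner_sum_left[OF pos]
          f_def)
    moreover have "(\<Sum>i\<in>UNIV. \<Sum>j\<in>UNIV. f i j) = (\<Sum>i\<in>UNIV. \<Sum>j\<in>UNIV. f j i)"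
      by (rule sum.swap)
    ultimately have "2 * A_inner ?D (operator_matrix T x) x
        = (\<Sum>i\<in>UNIV. \<Sum>j\<in>UNIV. f i j + f j i)"
      by (simp add: sum.distrib)
    then have "2 * cmod (A_inner ?D (operator_matrix T x) x)
        = cmod (\<Sum>i\<in>UNIV. \<Sum>j\<in>UNIV. f i j + f j i)"
      by (metis norm_mult norm_numeral)
    also have "\<dots> \<le> (\<Sum>i\<in>UNIV. \<Sum>j\<in>UNIV. 2 * (s i j * (a i * a j)))"
      by (intro sum_norm_le term_le)
    also have "\<dots> = 2 * (\<Sum>i\<in>UNIV. \<Sum>j\<in>UNIV. s i j * (a i * a j))"
      by (simp add: sum_distrib_left)
    finally have "cmod (A_inner ?D (operator_matrix T x) x)
        \<le> (\<Sum>i\<in>UNIV. \<Sum>j\<in>UNIV. s i j * (a i * a j))"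
      by simp
    also have "\<dots> = Re (cinner (S *v v) v)"
      by (simp add: cinner_vec_def cinner_complex_def matrix_vector_mult_def S_def v_def
          sum_distrib_right sum_distrib_left Re_sum ac_simps flip: s_def)
    also have "\<dots> \<le> numerical_radius S"
      by (rule order_trans[OF complex_Re_le_cmod cinner_le_numerical_radius[OF \<open>norm v = 1\<close>]])
    finally show ?thesis .
  qed
  moreover have "\<exists>x. A_norm ?D x = 1"
  proof -
    obtain h where h: "A_norm A h = 1" using ex_A_norm_eq_1[OF assms(1,2)] by blast
    fix k :: 'd
    have "(\<chi> i. A_norm A (axis k h $ i)) = axis k (1::real)"
      using h by (simp add: axis_def vec_eq_iff A_norm_def A_inner_def cinner_scaleR_right[of _ 0, simplified])
    then have "A_norm ?D (axis k h) = 1"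
      by (simp add: A_norm_diagonal_operator_matrix[OF pos])
    then show ?thesis ..
  qed
  ultimately show ?thesis
    unfolding A_numerical_radius_def by (intro cSup_least) auto
qed

end
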